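(* Let $A$ be a real $m\times n$ matrix with no zero rows, let $b\in\mathbb{R}^m$, and let $u=Fb$. Assume that the linear system $(I_n-R_A)x=u$ is consistent. Let $x_0\in\mathbb{R}^n$ be an arbitrarily chosen initial vector and define, for $k=0,1,2,\ldots$, $$x_{k+1}=x_k+2\,\frac{b_{i_k}-A_{i_k}^{T}x_k}{\|A_{i_k}\|^2}\,A_{i_k},\qquad i_k=(k\bmod m)+1 .$$ Then $\{x_0,x_m,x_{2m},x_{3m},\ldots\}$ lies on a sphere centered on the solution of $(I_n-R_A)x=u$ that has the minimal distance to $x_0$.
   Context: $A_i^{T}$ denotes the $i$-th row of $A$ (so $A_i$ is a column vector), $b_i$ the $i$-th entry of $b$, $\|\cdot\|$ the Euclidean norm, and $e_1,\ldots,e_m$ the standard basis of $\mathbb{R}^m$. Let $R_i=I_n-2\frac{A_iA_i^{T}}{\|A_i\|^2}$ and $R_A=R_m\cdots R_2R_1$. The $n\times m$ matrix $F$ is $$F=\sum_{j=1}^m\frac{2}{\|A_j\|^2}R_m\cdots R_{j+1}A_je_j^{T},$$ where $R_m\cdots R_{j+1}$ is the identity matrix when $j=m$. The system $Ax=b$ is not assumed consistent. *)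

theory Defs
  imports "HOL-Analysis.Analysis"
begin

text \<open>
  The rows of \<open>A :: real^'n^'m\<close> are numbered by a bijection \<open>\<iota>\<close> from
  \<open>{1..CARD('m)}\<close> onto \<open>'m\<close>, since a finite index type carries no order of its own.
  Row number \<open>i\<close> is \<open>row (\<iota> i) A\<close>, entry number \<open>i\<close> of \<open>b\<close> is \<open>b $ \<iota> i\<close>, and the
  \<open>i\<close>-th standard basis vector of \<open>real^'m\<close> is \<open>axis (\<iota> i) 1\<close>.
\<close>

text \<open>The matrix \<open>v w\<^sup>T\<close>.\<close>

definition outer :: "real^'r \<Rightarrow> real^'c \<Rightarrow> real^'c^'r" where
  "outer v w = (\<chi> i j. v $ i * w $ j)"

definition refl_mat :: "real^'n^'m \<Rightarrow> (nat \<Rightarrow> 'm) \<Rightarrow> nat \<Rightarrow> real^'n^'n" where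
  "refl_mat A \<iota> i =
     mat 1 - (2 / (norm (row (\<iota> i) A))\<^sup>2) *\<^sub>R outer (row (\<iota> i) A) (row (\<iota> i) A)"

text \<open>
  \<open>refl_prod A \<iota> j\<close> is \<open>R\<^sub>m \<cdots> R\<^sub>j\<^sub>+\<^sub>1\<close> with \<open>m = CARD('m)\<close>: later factors are multiplied
  on the left, and the product is the identity for \<open>j = m\<close>.
\<close>

definition refl_prod :: "real^'n^'m \<Rightarrow> (nat \<Rightarrow> 'm) \<Rightarrow> nat \<Rightarrow> real^'n^'n" where
  "refl_prod A \<iota> j = fold (\<lambda>i P. refl_mat A \<iota> i ** P) [j+1..<CARD('m)+1] (mat 1)"

definition R_mat :: "real^'n^'m \<Rightarrow> (nat \<Rightarrow> 'm) \<Rightarrow> real^'n^'n" where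
  "R_mat A \<iota> = refl_prod A \<iota> 0"

definition F_mat :: "real^'n^'m \<Rightarrow> (nat \<Rightarrow> 'm) \<Rightarrow> real^'m^'n" where
  "F_mat A \<iota> =
     (\<Sum>j=1..CARD('m). (2 / (norm (row (\<iota> j) A))\<^sup>2) *\<^sub>R
        (refl_prod A \<iota> j ** outer (row (\<iota> j) A) (axis (\<iota> j) 1)))"

definition nearest_solution :: "real^'n^'r \<Rightarrow> real^'r \<Rightarrow> real^'n \<Rightarrow> real^'n \<Rightarrow> bool" where
  "nearest_solution M u a c \<longleftrightarrow>
     M *v c = u \<and> (\<forall>y. M *v y = u \<longrightarrow> dist a c \<le> dist a y)"

end

theory Submission
  imports Defs
begin

text \<open>
  One sweep of \<open>m\<close> steps is the affine isometry \<open>y \<mapsto> R\<^sub>A y + u\<close>, whose fixed points are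
  exactly the solutions of \<open>(I - R\<^sub>A) y = u\<close>. Hence every such solution, in particular the
  one nearest to \<open>x\<^sub>0\<close>, has constant distance to \<open>x\<^sub>0, x\<^sub>m, x\<^sub>2\<^sub>m, \<dots>\<close>. The nearest one
  exists and is unique because the solutions form a nonempty closed convex set.
\<close>

lemma outer_mult_vec: "outer v w *v z = (w \<bullet> z) *\<^sub>R v"
  by (simp add: vec_eq_iff outer_def matrix_vector_mult_def inner_vec_def sum_distrib_left
      mult_ac)

lemma refl_mat_mult_vec:
  "refl_mat A \<iota> i *v v =
     v - (2 * (row (\<iota> i) A \<bullet> v) / (norm (row (\<iota> i) A))\<^sup>2) *\<^sub>R row (\<iota> i) A"
  by (simp add: refl_mat_def matrix_vector_mult_diff_rdistrib
      scaleR_matrix_vector_assoc[symmetric] outer_mult_vec)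

lemma norm_refl_mat: "norm (refl_mat A \<iota> i *v v) = norm v"
proof (cases "row (\<iota> i) A = 0")
  case False
  let ?a = "row (\<iota> i) A"
  \<comment> \<open>This \<open>t\<close> is the nonzero root of
    \<open>t * (t * (?a \<bullet> ?a) - 2 * (?a \<bullet> v))\<close> when
    \<open>?a \<bullet> v\<close> is nonzero, so the change in squared length vanishes.\<close>
  define t where "t = 2 * (?a \<bullet> v) / (?a \<bullet> ?a)"
  have t: "t * (?a \<bullet> ?a) = 2 * (?a \<bullet> v)"
    using False by (simp add: t_def)
  have "refl_mat A \<iota> i *v v = v - t *\<^sub>R ?a"
    by (simp add: refl_mat_mult_vec t_def dot_square_norm)
  moreover have "(v - t *\<^sub>R ?a) \<bullet> (v - t *\<^sub>R ?a) =
      v \<bullet> v + t * (t * (?a \<bullet> ?a) - 2 * (?a \<bullet> v))"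
    by (simp add: inner_diff_left inner_diff_right inner_commute algebra_simps)
  ultimately show ?thesis
    by (simp add: norm_eq t)
\<comment> \<open>For a zero row the subtracted multiple of the row is zero and the matrix acts as
  the identity.\<close>
qed (simp add: refl_mat_mult_vec)

text \<open>Each new factor goes on the left, so the seed stays the rightmost factor and
  associativity splits it off. This gives access to the factor that the fold consumes first.\<close>

lemma fold_matrix_mult:
  fixes f :: "'i \<Rightarrow> real^'n^'n" and P :: "real^'k^'n"
  shows "fold (\<lambda>i Q. f i ** Q) is P = fold (\<lambda>i Q. f i ** Q) is (mat 1) ** P"
proof (induction "is" rule: rev_induct)
  case (snoc i "is")
  then show ?case
    by (simp add: matrix_mul_assoc)
qed simp

lemma refl_prod_CARD: "refl_prod (A :: real^'n^'m) \<iota> CARD('m) = mat 1"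
  by (simp add: refl_prod_def)

lemma refl_prod_less_CARD:
  fixes A :: "real^'n^'m"
  assumes "j < CARD('m)"
  shows "refl_prod A \<iota> j = refl_prod A \<iota> (Suc j) ** refl_mat A \<iota> (Suc j)"
proof -
  have "[j+1..<CARD('m)+1] = Suc j # [Suc j+1..<CARD('m)+1]"
    using assms by (simp add: upt_conv_Cons)
  then show ?thesis
    unfolding refl_prod_def by (simp add: fold_matrix_mult[of _ _ "refl_mat A \<iota> (Suc j)"])
qed

lemma norm_refl_prod:
  fixes A :: "real^'n^'m"
  assumes "j \<le> CARD('m)"
  shows "norm (refl_prod A \<iota> j *v v) = norm v"
  using assms
\<comment> \<open>Downward from j = m, where the product is empty. The vector varies because the
  induction hypothesis is applied to \<open>refl_mat A \<iota> (Suc j) *v v\<close>.\<close>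
proof (induction j arbitrary: v rule: inc_induct)
  case (step j)
  then show ?case
    by (simp add: refl_prod_less_CARD matrix_vector_mul_assoc[symmetric] norm_refl_mat)
qed (simp add: refl_prod_CARD)

lemma sum_matrix_vector_mult: "(\<Sum>i\<in>I. M i) *v v = (\<Sum>i\<in>I. M i *v v)"
  by (induction I rule: infinite_finite_induct)
    (simp_all add: matrix_vector_mult_add_rdistrib)

lemma F_mat_mult_vec:
  fixes A :: "real^'n^'m"
  shows "F_mat A \<iota> *v b =
    (\<Sum>j=1..CARD('m). (2 * b $ \<iota> j / (norm (row (\<iota> j) A))\<^sup>2) *\<^sub>R
       (refl_prod A \<iota> j *v row (\<iota> j) A))"
  by (simp add: F_mat_def sum_matrix_vector_mult scaleR_matrix_vector_assoc[symmetric]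
      matrix_vector_mul_assoc[symmetric] outer_mult_vec inner_axis'
      matrix_vector_mult_scaleR)

text \<open>The right-hand side is invariant in j: the remaining reflections act on the current
  iterate, and the sum collects what the rows still to come contribute through \<open>b\<close>. At
  j = m it is \<open>y CARD('m)\<close>; at j = 0 the sum is the expansion of
  \<open>F_mat A \<iota> *v b\<close>.\<close>

lemma partial_sweep:
  fixes A :: "real^'n^'m" and y :: "nat \<Rightarrow> real^'n"
  assumes step: "\<And>j. j < CARD('m) \<Longrightarrow> y (Suc j) =
      y j + (2 * ((b $ \<iota> (Suc j) - row (\<iota> (Suc j)) A \<bullet> y j) / (norm (row (\<iota> (Suc j)) A))\<^sup>2))
        *\<^sub>R row (\<iota> (Suc j)) A"
    and "j \<le> CARD('m)"
  shows "y CARD('m) = refl_prod A \<iota> j *v y j +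
    (\<Sum>i\<in>{Suc j..CARD('m)}. (2 * b $ \<iota> i / (norm (row (\<iota> i) A))\<^sup>2) *\<^sub>R
       (refl_prod A \<iota> i *v row (\<iota> i) A))"
  using assms(2)
proof (induction j rule: inc_induct)
  case base
  then show ?case by (simp add: refl_prod_CARD)
next
  case (step j)
  let ?a = "row (\<iota> (Suc j)) A"
  let ?s = "2 * b $ \<iota> (Suc j) / (norm ?a)\<^sup>2"
  \<comment> \<open>The part of the update linear in \<open>y j\<close> is the reflection; the part
    with \<open>b\<close> is a fixed multiple of the row.\<close>
  have "y (Suc j) = refl_mat A \<iota> (Suc j) *v y j + ?s *\<^sub>R ?a"
    by (simp add: assms(1)[OF step.hyps(2)] refl_mat_mult_vec diff_divide_distrib
        right_diff_distrib scaleR_diff_left)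
  then have "refl_prod A \<iota> (Suc j) *v y (Suc j) =
      refl_prod A \<iota> j *v y j + ?s *\<^sub>R (refl_prod A \<iota> (Suc j) *v ?a)"
    by (simp add: refl_prod_less_CARD[OF step.hyps(2)] matrix_vector_right_distrib
        matrix_vector_mul_assoc[symmetric] matrix_vector_mult_scaleR)
  moreover have "{Suc j..CARD('m)} = insert (Suc j) {Suc (Suc j)..CARD('m)}"
    using step.hyps by auto
  ultimately show ?case
    using step.IH by (simp add: add.assoc)
qed

lemma ex1_nearest_solution:
  assumes "\<exists>y. M *v y = u"
  shows "\<exists>!c. nearest_solution M u a c"
proof -
  let ?S = "{y. M *v y = u}"
  have ne: "?S \<noteq> {}" using assms by auto
  have cl: "closed ?S"
    by (intro closed_Collect_eq continuous_intros matrix_vector_mult_linear_continuous_on)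
  \<comment> \<open>For s + t = 1 the image of an affine combination is s u + t u = (s + t) u =
    u.\<close>
  have "affine ?S"
    by (auto simp: affine_def matrix_vector_right_distrib matrix_vector_mult_scaleR
        scaleR_add_left[symmetric])
  then have cv: "convex ?S" by (rule affine_imp_convex)
  show ?thesis
  proof (rule ex1I)
    show "nearest_solution M u a (closest_point ?S a)"
      using closest_point_exists[OF cl ne] by (auto simp: nearest_solution_def)
  next
    \<comment> \<open>A nearest point of a closed convex set is its metric projection, hence
      unique.\<close>
    fix c assume "nearest_solution M u a c"
    then show "c = closest_point ?S a"
      by (intro closest_point_unique[OF cv cl]) (auto simp: nearest_solution_def)
  qed
qed

theorem theorem22:
  fixes A :: "real^'n^'m" and b :: "real^'m" and u :: "real^'n"
    and \<iota> :: "nat \<Rightarrow> 'm" and x :: "nat \<Rightarrow> real^'n"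
  assumes numbering: "bij_betw \<iota> {1..CARD('m)} UNIV"
    and no_zero_rows: "\<forall>i. row i A \<noteq> 0"
    and u_def: "u = F_mat A \<iota> *v b"
    and consistent: "\<exists>y. (mat 1 - R_mat A \<iota>) *v y = u"
    and iteration: "\<forall>k. x (Suc k) =
          (let i = \<iota> (k mod CARD('m) + 1)
           in x k + (2 * ((b $ i - row i A \<bullet> x k) / (norm (row i A))\<^sup>2)) *\<^sub>R row i A)"
  shows "(\<exists>!c. nearest_solution (mat 1 - R_mat A \<iota>) u (x 0) c) \<and>
    (\<forall>c. nearest_solution (mat 1 - R_mat A \<iota>) u (x 0) c \<longrightarrow>
       (\<exists>r. {x (q * CARD('m)) | q. True} \<subseteq> sphere c r))"
proof (intro conjI allI impI)
  show "\<exists>!c. nearest_solution (mat 1 - R_mat A \<iota>) u (x 0) c"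
    using consistent by (rule ex1_nearest_solution)
next
  fix c assume "nearest_solution (mat 1 - R_mat A \<iota>) u (x 0) c"
  then have fixed: "c = R_mat A \<iota> *v c + u"
    by (simp add: nearest_solution_def matrix_vector_mult_diff_rdistrib algebra_simps)
  \<comment> \<open>For j < m, (q m + j) mod m + 1 = j + 1, so each sweep uses the rows in the order
    1, ..., m.\<close>
  have sweep: "x (Suc q * CARD('m)) = R_mat A \<iota> *v x (q * CARD('m)) + u" for q
    using partial_sweep[of "\<lambda>j. x (q * CARD('m) + j)" b \<iota> A 0] iteration
    by (simp add: Let_def u_def F_mat_mult_vec R_mat_def add.commute)
  have "dist c (x (q * CARD('m))) = dist c (x 0)" for q
  proof (induction q)
    case (Suc q)
    \<comment> \<open>The translation by \<open>u\<close> cancels in the difference, leaving a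
      norm-preserving linear map.\<close>
    have "c - x (Suc q * CARD('m)) = R_mat A \<iota> *v (c - x (q * CARD('m)))"
      using fixed sweep[of q] by (simp add: matrix_vector_mult_diff_distrib algebra_simps)
    then show ?case
      using Suc by (simp add: dist_norm R_mat_def norm_refl_prod)
  qed simp
  then show "\<exists>r. {x (q * CARD('m)) |q. True} \<subseteq> sphere c r"
    \<comment> \<open>The radius is 0 exactly when \<open>x 0\<close> is itself the nearest
      solution.\<close>
    by (intro exI[of _ "dist c (x 0)"]) auto
qed

end
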